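(* Let $P_0=v=(v_0,\dots,v_5)\in\mathbb C^6$ be any closed hexagon in the plane (no convexity, simplicity, or non-degeneracy assumptions are imposed). For $n\ge 0$ let $P_{n+1}=MP_n$ be the hexagon obtained from $P_n$ by joining the midpoints of consecutive edges, and let $G_n=G(P_n)$ be the centroid of $P_n$. Then there is a fixed line in the plane (depending on $P_0$ but not on $n$) on which all the points $G_n$ with $n\ge 1$ lie, and the points $G_n$ converge, eventually monotonically along this line, to the centroid $\frac{1}{6}(v_0+v_1+\dots+v_5)$ of the vertices of $P_0$.
   Context: The plane is identified with $\mathbb C$. A hexagon is any vector $v=(v_0,\dots,v_5)\in\mathbb C^6$ (its entries are its vertices, in cyclic order; self-intersecting and degenerate hexagons are allowed). Indices are modulo $6$. The midpoint map $M:\mathbb C^6\to\mathbb C^6$ is $(Mv)_k=\frac12(v_k+v_{k+1})$. The centroid of a hexagon $v$ is defined algebraically by $$G(v)=\frac{Z(v)}{6A(v)},\qquad A(v)=\frac12\sum_{k=0}^{5}\operatorname{Im}(\bar v_kv_{k+1}),\qquad Z(v)=\sum_{k=0}^{5}(v_k+v_{k+1})\operatorname{Im}(\bar v_kv_{k+1}),$$ where $A(v)\in\mathbb R$ is the signed area; for simple hexagons $G(v)$ is the centroid of the filled polygon. The quotient is meaningful when $A(v)\neq0$; assertions about $G_n$ refer to those $n$ for which it is defined. Eventually monotone along a line means that the real coordinate along the line is monotone in $n$ for all sufficiently large $n$.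
   Formalization: Convergence is claimed except when the first and fifth Fourier coefficients of P_0 have equal modulus, A(P_1) is nonzero and G_1 is not the vertex centroid; then G_n diverges, e.g. for (4, i, -2-i, 0, -2+i, -i). The line and monotonicity hold for all hexagons. *)

theory Defs
  imports "HOL-Analysis.Analysis"
begin

(* Indices live in the numeral type 6, whose arithmetic is arithmetic modulo 6,
   so k + 1 is the cyclic successor. *)
type_synonym hexagon = "complex ^ 6"

definition midpoint_map :: "hexagon \<Rightarrow> hexagon" where
  "midpoint_map v = (\<chi> k. (v $ k + v $ (k + 1)) / 2)"

definition signed_area :: "hexagon \<Rightarrow> real" where
  "signed_area v = (\<Sum>k\<in>UNIV. Im (cnj (v $ k) * v $ (k + 1))) / 2"

definition area_moment :: "hexagon \<Rightarrow> complex" where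
  "area_moment v =
     (\<Sum>k\<in>UNIV. (v $ k + v $ (k + 1)) * of_real (Im (cnj (v $ k) * v $ (k + 1))))"

(* Meaningful only if signed_area v is nonzero; otherwise it is the junk value 0. *)
definition area_centroid :: "hexagon \<Rightarrow> complex" where
  "area_centroid v = area_moment v / of_real (6 * signed_area v)"

definition vertex_centroid :: "hexagon \<Rightarrow> complex" where
  "vertex_centroid v = (\<Sum>k\<in>UNIV. v $ k) / 6"

definition fourier_coeff :: "hexagon \<Rightarrow> nat \<Rightarrow> complex" where
  "fourier_coeff v j = (\<Sum>k<6. v $ of_nat k * cis (- (2 * pi * real j * real k / 6))) / 6"

(* Write P n for the n-th iterate of v under midpoint_map, c j for fourier_coeff v j and g for
   vertex_centroid v. For n \<ge> 1, with real constants a and b that are fixed nonzero multiples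
   of |c 1|^2 - |c 5|^2 and |c 2|^2 - |c 4|^2, and with a constant w depending on v,
     signed_area (P n) = a (3/4)^n + b (1/4)^n,
     area_moment (P n) - 6 signed_area (P n) g = (3/8)^n w.
   If a = 0 and both b and w are nonzero, then area_centroid (P n) - g is a nonzero constant
   times (3/2)^n: all areas are nonzero and the centroids run off to infinity. For example,
   the hexagon 4, i, -2-i, 0, -2+i, -i has g = 0 and area_centroid (P n) = (2/3) (3/2)^n.
   The predicate below singles out exactly these hexagons; the last two conjuncts say that b and w are
   nonzero once a = 0. *)
definition escaping :: "hexagon \<Rightarrow> bool" where
  "escaping v \<longleftrightarrow>
     cmod (fourier_coeff v 1) = cmod (fourier_coeff v 5) \<and>
     signed_area (midpoint_map v) \<noteq> 0 \<and>
     area_centroid (midpoint_map v) \<noteq> vertex_centroid v"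

end

theory Submission
  imports Defs
begin

text \<open>
  Why the centroids are collinear: in the Fourier basis of \<open>\<complex>\<^sup>6\<close> the midpoint map multiplies the
  \<open>j\<close>-th mode by \<open>(1 + \<omega>\<^sup>j) / 2\<close>, where \<open>\<omega> = cis (pi / 3)\<close>. These factors have modulus \<open>1\<close>, \<open>sqrt 3 / 2\<close>,
  \<open>1 / 2\<close>, \<open>0\<close>, \<open>1 / 2\<close>, \<open>sqrt 3 / 2\<close>. The area is a Hermitian form that is diagonal in the modes, so it
  is a combination of \<open>(3 / 4) ^ n\<close> and \<open>(1 / 4) ^ n\<close>. The area moment about the vertex centroid is a cubic
  form in the modes and their conjugates, equivariant under rotations and invariant under the cyclic
  shift of the vertices. This leaves the products of two modes with the conjugate of a third whose index
  is their sum modulo \<open>6\<close>. Those with nonzero coefficient that avoid the third mode involve two modes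
  with factor of modulus \<open>sqrt 3 / 2\<close> and one with factor of modulus \<open>1 / 2\<close>, and the phases cancel.
  So, as soon as one midpoint step has removed the third mode, the moment as a complex vector is merely multiplied by the real number \<open>3 / 4 * (1 / 2) = 3 / 8\<close> in each step. A
  moment of constant direction divided by a real area moves along a line.

  The proof below reaches these decay rates without diagonalizing. The area and the total area of the
  two triangles formed by every other vertex are mixed by a symmetric matrix with eigenvalues
  \<open>3 / 4\<close> and \<open>1 / 4\<close> (\<open>signed_area_iterate\<close>), and the factor \<open>3 / 8\<close> comes from a polynomial identity for
  two triples of points that each sum to zero (\<open>area_moment_midpoint_map_balanced\<close>). The real coordinate
  on the line is then \<open>(3 / 8) ^ n / (a * (3 / 4) ^ n + b * (1 / 4) ^ n)\<close>, and elementary estimates show that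
  it is eventually monotone, and that it tends to \<open>0\<close> if \<open>a \<noteq> 0\<close>. Fourier coefficients enter only to
  recognize \<open>a\<close> as a multiple of \<open>\<bar>c\<^sub>1\<bar>\<^sup>2 - \<bar>c\<^sub>5\<bar>\<^sup>2\<close>
  (\<open>signed_area_add_triangles_area_fourier\<close>), which identifies the hexagons with \<open>a = 0\<close>.
  For these, either the centroids stay at the vertex centroid, or all areas vanish, or the centroids
  escape like \<open>(3 / 2) ^ n\<close>.
\<close>

section \<open>Cross products and cyclic sums\<close>

definition cross :: "complex \<Rightarrow> complex \<Rightarrow> real" where
  "cross z w = Im (cnj z * w)"

lemma cross_Re_Im: "cross z w = Re z * Im w - Im z * Re w"
  by (simp add: cross_def)

lemma cross_bilinear:
  "cross (x + y) w = cross x w + cross y w" "cross w (x + y) = cross w x + cross w y"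
  "cross (x - y) w = cross x w - cross y w" "cross w (x - y) = cross w x - cross w y"
  "cross (- x) w = - cross x w" "cross w (- x) = - cross w x"
  "cross (x / 2) w = cross x w / 2" "cross w (x / 2) = cross w x / 2"
  "cross x x = 0"
  by (simp_all add: cross_Re_Im algebra_simps diff_divide_distrib)

lemma cross_swap: "cross w z = - cross z w"
  by (simp add: cross_Re_Im)

lemma UNIV_6: "(UNIV :: 6 set) = {0, 1, 2, 3, 4, 5}"
proof -
  have "card {0, 1, 2, 3, 4, 5 :: 6} = CARD(6)" by simp
  then show ?thesis
    using card_subset_eq[of "UNIV :: 6 set" "{0, 1, 2, 3, 4, 5}"] by simp
qed

lemma sum_UNIV_6:
  fixes f :: "6 \<Rightarrow> 'a::comm_monoid_add"
  shows "(\<Sum>k\<in>UNIV. f k) = f 0 + f 1 + f 2 + f 3 + f 4 + f 5"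
  unfolding UNIV_6 by (simp add: add.assoc)

lemma numerals_mod_6: "(6 :: 6) = 0" "(7 :: 6) = 1"
  by simp_all

lemma sum_cyclic_shift:
  fixes f :: "'k::{finite,ring_1} \<Rightarrow> 'a::comm_monoid_add"
  shows "(\<Sum>k\<in>UNIV. f (k + j)) = (\<Sum>k\<in>UNIV. f k)"
  by (rule sum.reindex_bij_witness[where i = "\<lambda>k. k - j" and j = "\<lambda>k. k + j"]) auto

section \<open>Decay of the area\<close>

text \<open>
  The sum of the signed areas of the triangles \<open>v\<^sub>0 v\<^sub>2 v\<^sub>4\<close> and \<open>v\<^sub>1 v\<^sub>3 v\<^sub>5\<close>. It is the only further
  quantity needed to describe how the area evolves.
\<close>

definition triangles_area :: "hexagon \<Rightarrow> real" where
  "triangles_area v = (\<Sum>k\<in>UNIV. cross (v $ k) (v $ (k + 2))) / 2"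

lemma signed_area_cross: "signed_area v = (\<Sum>k\<in>UNIV. cross (v $ k) (v $ (k + 1))) / 2"
  by (simp add: signed_area_def cross_def)

text \<open>
  Each long diagonal is traversed once in each direction.
\<close>

lemma sum_cross_opposite: "(\<Sum>k\<in>UNIV. cross (v $ k) (v $ (k + 3))) = 0" for v :: hexagon
proof -
  have "(\<Sum>k\<in>UNIV. cross (v $ k) (v $ (k + 3))) = (\<Sum>k\<in>UNIV. cross (v $ (k + 3)) (v $ (k + 3 + 3)))"
    by (rule sum_cyclic_shift[symmetric])
  also have "\<dots> = (\<Sum>k\<in>UNIV. - cross (v $ k) (v $ (k + 3)))"
    by (simp add: add.assoc cross_swap[of "v $ (_ + 3)"] numerals_mod_6)
  finally show ?thesis
    by (simp add: sum_negf)
qed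

lemma signed_area_midpoint_map:
  "signed_area (midpoint_map v) = signed_area v / 2 + triangles_area v / 4"
proof -
  have "signed_area (midpoint_map v) =
    (\<Sum>k\<in>UNIV. cross (v $ k) (v $ (k + 1)) + cross (v $ k) (v $ (k + 2))
       + cross (v $ (k + 1)) (v $ (k + 1 + 1))) / 8"
    by (simp add: signed_area_cross midpoint_map_def cross_bilinear add.assoc
        flip: sum_divide_distrib add_divide_distrib)
  then show ?thesis
    by (simp only: sum.distrib sum_cyclic_shift[of "\<lambda>k. cross (v $ k) (v $ (k + 1))"])
       (simp add: signed_area_cross triangles_area_def)
qed

lemma triangles_area_midpoint_map:
  "triangles_area (midpoint_map v) = triangles_area v / 2 + signed_area v / 4"
proof -
  have "triangles_area (midpoint_map v) =
    (\<Sum>k\<in>UNIV. cross (v $ k) (v $ (k + 2)) + cross (v $ (k + 1)) (v $ (k + 1 + 1))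
       + cross (v $ k) (v $ (k + 3)) + cross (v $ (k + 1)) (v $ (k + 1 + 2))) / 8"
    by (simp add: triangles_area_def midpoint_map_def cross_bilinear add.assoc
        flip: sum_divide_distrib add_divide_distrib)
  then show ?thesis
    by (simp only: sum.distrib sum_cyclic_shift[of "\<lambda>k. cross (v $ k) (v $ (k + 1))"]
          sum_cyclic_shift[of "\<lambda>k. cross (v $ k) (v $ (k + 2))"] sum_cross_opposite)
       (simp add: signed_area_cross triangles_area_def)
qed

text \<open>
  The symmetric roles of the two areas in the preceding recursions make their sum and their difference
  eigenvectors, with eigenvalues \<open>1 / 2 + 1 / 4\<close> and \<open>1 / 2 - 1 / 4\<close>.
\<close>

lemma signed_area_iterate:
  "signed_area ((midpoint_map ^^ n) v) =
     (signed_area v + triangles_area v) / 2 * (3 / 4) ^ n + (signed_area v - triangles_area v) / 2 * (1 / 4) ^ n"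
proof -
  have "signed_area ((midpoint_map ^^ n) v) + triangles_area ((midpoint_map ^^ n) v)
      = (signed_area v + triangles_area v) * (3 / 4) ^ n"
    by (induction n) (simp_all add: signed_area_midpoint_map triangles_area_midpoint_map field_simps)
  moreover have "signed_area ((midpoint_map ^^ n) v) - triangles_area ((midpoint_map ^^ n) v)
      = (signed_area v - triangles_area v) * (1 / 4) ^ n"
    by (induction n) (simp_all add: signed_area_midpoint_map triangles_area_midpoint_map field_simps)
  ultimately show ?thesis
    by argo
qed

text \<open>
  For \<open>j = 1\<close> and \<open>j = 5\<close> the root of unity in the Fourier sum is primitive of order six, that is, a root of
  the cyclotomic polynomial \<open>z\<^sup>2 - z + 1\<close>. This reduces the sum to an expression linear in \<open>z\<close>.
\<close>

lemma fourier_coeff_primitive_sixth_root: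
  assumes z: "cis (- (2 * pi * real j / 6)) = z" and z2: "z\<^sup>2 = z - 1"
  shows "fourier_coeff v j =
    (v $ 0 - v $ 3 - (v $ 2 - v $ 5) + (v $ 1 - v $ 4 + (v $ 2 - v $ 5)) * z) / 6"
proof -
  have "cis (- (2 * pi * real j * real k / 6)) = z ^ k" for k
  proof -
    have "z ^ k = cis (real k * - (2 * pi * real j / 6))"
      unfolding z[symmetric] by (rule Complex.DeMoivre)
    then show ?thesis by (simp add: mult_ac)
  qed
  then have "fourier_coeff v j = (\<Sum>k<6. v $ of_nat k * z ^ k) / 6"
    by (simp add: fourier_coeff_def)
  moreover have "{..<6::nat} = {0, 1, 2, 3, 4, 5}"
    by auto
  moreover have "z^3 = -1" "z^4 = -z" "z^5 = 1 - z"
    using z2 by algebra+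
  ultimately show ?thesis
    using z2 by (simp add: algebra_simps)
qed

text \<open>
  The Hermitian form that decays like \<open>(3 / 4) ^ n\<close> is supported on the modes whose multiplier has modulus
  \<open>sqrt 3 / 2\<close>, namely the first and the fifth. They wind in opposite directions, hence the signs.
\<close>

lemma signed_area_add_triangles_area_fourier:
  "signed_area v + triangles_area v =
     3 * sqrt 3 * ((cmod (fourier_coeff v 1))\<^sup>2 - (cmod (fourier_coeff v 5))\<^sup>2)"
proof -
  define s where "s = sqrt 3"
  have s2: "s * s = 3" by (simp add: s_def)
  define x where "x = v $ 0 - v $ 3 - (v $ 2 - v $ 5)"
  define y where "y = v $ 1 - v $ 4 + (v $ 2 - v $ 5)"
  have "cis (- (2 * pi * real 1 / 6)) = Complex (1/2) (- s / 2)"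
    by (simp add: complex_eq_iff cos_60 sin_60 s_def)
  from fourier_coeff_primitive_sixth_root[OF this]
  have c1: "fourier_coeff v 1 = (x + y * Complex (1/2) (- s / 2)) / 6"
    by (simp add: complex_eq_iff power2_eq_square s2 x_def y_def)
  have "- (2 * pi * real 5 / 6) = pi / 3 - 2 * pi"
    by simp
  then have "cis (- (2 * pi * real 5 / 6)) = cis (pi / 3)"
    by (simp only: complex_eq_iff cis.sel cos_diff sin_diff) simp
  then have "cis (- (2 * pi * real 5 / 6)) = Complex (1/2) (s / 2)"
    by (simp only:) (simp add: complex_eq_iff cos_60 sin_60 s_def)
  from fourier_coeff_primitive_sixth_root[OF this]
  have c5: "fourier_coeff v 5 = (x + y * Complex (1/2) (s / 2)) / 6"
    by (simp add: complex_eq_iff power2_eq_square s2 x_def y_def)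
  have "3 * s * ((cmod (fourier_coeff v 1))\<^sup>2 - (cmod (fourier_coeff v 5))\<^sup>2)
      = 3 * s * (s * cross x y / 18)"
    unfolding c1 c5 cmod_power2 by (simp add: cross_Re_Im power2_eq_square field_simps)
  also have "\<dots> = (s * s) * cross x y / 6"
    by simp
  also have "\<dots> = cross x y / 2"
    unfolding s2 by simp
  also have "\<dots> = signed_area v + triangles_area v"
    by (simp add: signed_area_cross triangles_area_def sum_UNIV_6 numerals_mod_6 x_def y_def
        cross_Re_Im field_simps)
  finally show ?thesis by (simp add: s_def)
qed

section \<open>Decay of the area moment about the vertex centroid\<close>

lemma area_moment_cross:
  "area_moment v = (\<Sum>k\<in>UNIV. (v $ k + v $ (k + 1)) * of_real (cross (v $ k) (v $ (k + 1))))"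
  by (simp add: area_moment_def cross_def)

text \<open>
  The term \<open>h z - h w\<close> telescopes along any closed polygon, so a translation by \<open>- g\<close> lowers the moment
  by \<open>3 * g\<close> times the doubled area. Collecting terms uses the three-term relation
  \<open>z * cross g w - w * cross g z = g * cross z w\<close>.
\<close>

lemma area_moment_edge_translate:
  fixes g z w :: complex
  defines "h \<equiv> \<lambda>z. (z - 2 * g) * of_real (cross g z)"
  shows "(z - g + (w - g)) * of_real (cross (z - g) (w - g)) =
           (z + w) * of_real (cross z w) - 3 * g * of_real (cross z w) + (h z - h w)"
  unfolding h_def by (simp add: cross_Re_Im complex_eq_iff algebra_simps)

lemma area_moment_translate:
  "area_moment (\<chi> k. v $ k - g) = area_moment v - of_real (6 * signed_area v) * g"
proof -
  define h where "h z = (z - 2 * g) * of_real (cross g z)" for z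
  have "area_moment (\<chi> k. v $ k - g) = area_moment v
      - 3 * g * of_real (\<Sum>k\<in>UNIV. cross (v $ k) (v $ (k + 1)))
      + ((\<Sum>k\<in>UNIV. h (v $ k)) - (\<Sum>k\<in>UNIV. h (v $ (k + 1))))"
    unfolding area_moment_cross vec_lambda_beta area_moment_edge_translate h_def
    by (simp add: sum.distrib sum_subtractf sum_distrib_left)
  then show ?thesis
    by (simp add: sum_cyclic_shift[of "\<lambda>k. h (v $ k)"] signed_area_cross)
qed

text \<open>
  Here \<open>f z w\<close> is the contribution of the edge from \<open>z\<close> to \<open>w\<close> to the area moment, and \<open>a, p, b, q, c, r\<close>
  are the vertices of a hexagon. Once \<open>c\<close> and \<open>r\<close> are eliminated and the six cross products of
  \<open>a, b, p, q\<close> are treated as independent coefficients, both sides agree term by term.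
\<close>

lemma hexagon_midpoint_identity:
  fixes a b c p q r :: complex
  defines "f \<equiv> \<lambda>z w. (z + w) * of_real (cross z w)"
  assumes "a + b + c = 0" and "p + q + r = 0"
  shows "f (a + p) (p + b) + f (p + b) (b + q) + f (b + q) (q + c) + f (q + c) (c + r)
      + f (c + r) (r + a) + f (r + a) (a + p)
    = 3 * (f a p + f p b + f b q + f q c + f c r + f r a)"
proof -
  have "c = - a - b" "r = - p - q"
    using assms(2,3) by algebra+
  then show ?thesis
    unfolding f_def
    by (simp only: cross_bilinear cross_swap[of b a] cross_swap[of p a] cross_swap[of q a]
        cross_swap[of p b] cross_swap[of q b] cross_swap[of q p])
       (simp add: ring_distribs)
qed

text \<open>
  The two hypotheses say that the modes \<open>0\<close> and \<open>3\<close> vanish. The factor is \<open>3\<close> from the identity for sums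
  of adjacent vertices, divided by \<open>8\<close> because the moment is cubic and midpoints are half these sums.
\<close>

lemma area_moment_midpoint_map_balanced:
  assumes "u $ 0 + u $ 2 + u $ 4 = 0" "u $ 1 + u $ 3 + u $ 5 = 0"
  shows "area_moment (midpoint_map u) = 3 / 8 * area_moment u"
proof -
  define f where "f z w = (z + w) * of_real (cross z w)" for z w :: complex
  have half: "f (z / 2) (w / 2) = f z w / 8" for z w
    by (simp add: f_def cross_bilinear add_divide_distrib)
  have vertices: "area_moment w = f (w $ 0) (w $ 1) + f (w $ 1) (w $ 2) + f (w $ 2) (w $ 3)
      + f (w $ 3) (w $ 4) + f (w $ 4) (w $ 5) + f (w $ 5) (w $ 0)" for w
    by (simp add: area_moment_cross f_def sum_UNIV_6 numerals_mod_6)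
  show ?thesis
    using hexagon_midpoint_identity[OF assms, folded f_def]
    by (simp add: vertices midpoint_map_def numerals_mod_6 half flip: add_divide_distrib)
qed

lemma vertex_centroid_midpoint_map: "vertex_centroid (midpoint_map v) = vertex_centroid v"
  by (simp add: vertex_centroid_def midpoint_map_def sum.distrib sum_cyclic_shift[of "($) v"]
      flip: sum_divide_distrib)

lemma midpoint_map_translate:
  "midpoint_map (\<chi> k. v $ k - g) = (\<chi> k. midpoint_map v $ k - g)"
  by (simp add: midpoint_map_def vec_eq_iff field_simps)

text \<open>
  In a hexagon of midpoints the alternate vertices have the same sum, each being half the sum of all
  original vertices. So, relative to \<open>g\<close>, such a hexagon is balanced. The original hexagon in general is
  not, which is why the decay starts only after the first step.
\<close>

lemma area_moment_about_vertex_centroid: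
  assumes "g = vertex_centroid v"
  shows "area_moment (\<chi> k. midpoint_map (midpoint_map v) $ k - g)
    = 3 / 8 * area_moment (\<chi> k. midpoint_map v $ k - g)"
  unfolding midpoint_map_translate[symmetric, of "midpoint_map v"]
  by (rule area_moment_midpoint_map_balanced)
     (simp_all add: assms vertex_centroid_def midpoint_map_def sum_UNIV_6 numerals_mod_6 field_simps)

lemma area_moment_iterate:
  assumes "n \<ge> 1" and g: "g = vertex_centroid v"
  shows "area_moment (\<chi> k. (midpoint_map ^^ n) v $ k - g)
    = of_real ((3 / 8) ^ n) * (8 / 3 * area_moment (\<chi> k. midpoint_map v $ k - g))"
  using \<open>n \<ge> 1\<close>
proof (induction n rule: dec_induct)
  case base
  then show ?case by simp
next
  case (step n)
  have "vertex_centroid ((midpoint_map ^^ m) v) = g" for m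
    by (induction m) (simp_all add: g vertex_centroid_midpoint_map)
  then obtain u where u: "(midpoint_map ^^ n) v = midpoint_map u" "vertex_centroid u = g"
    using step(1) by (cases n) auto
  have "area_moment (\<chi> k. (midpoint_map ^^ Suc n) v $ k - g)
      = 3 / 8 * area_moment (\<chi> k. (midpoint_map ^^ n) v $ k - g)"
    using area_moment_about_vertex_centroid[of g u] u by simp
  then show ?case
    by (simp only: step(3)) simp
qed

section \<open>Position on the line\<close>

text \<open>
  The decay of the moment relative to that of an area with components \<open>a\<close> and \<open>b\<close> along its two modes.
\<close>

definition mode_ratio :: "real \<Rightarrow> real \<Rightarrow> nat \<Rightarrow> real" where
  "mode_ratio a b n = (3 / 8) ^ n / (a * (3 / 4) ^ n + b * (1 / 4) ^ n)"

text \<open>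
  The constant \<open>4 / 9\<close> is \<open>8 / 3\<close>, which extrapolates the moment from the first hexagon back to \<open>n = 0\<close>,
  divided by the \<open>6\<close> in the definition of the centroid.
\<close>

lemma area_centroid_iterate:
  assumes "n \<ge> 1" and A: "signed_area ((midpoint_map ^^ n) v) \<noteq> 0"
  shows "area_centroid ((midpoint_map ^^ n) v) = vertex_centroid v
    + of_real (mode_ratio ((signed_area v + triangles_area v) / 2) ((signed_area v - triangles_area v) / 2) n)
      * (4 / 9 * area_moment (\<chi> k. midpoint_map v $ k - vertex_centroid v))"
proof -
  define A where "A = signed_area ((midpoint_map ^^ n) v)"
  define g where "g = vertex_centroid v"
  define m where "m = area_moment (\<chi> k. midpoint_map v $ k - g)"
  have r: "mode_ratio ((signed_area v + triangles_area v) / 2) ((signed_area v - triangles_area v) / 2) n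
      = (3 / 8) ^ n / A"
    by (simp only: mode_ratio_def A_def signed_area_iterate)
  have "area_moment ((midpoint_map ^^ n) v) = of_real (6 * A) * g + of_real ((3 / 8) ^ n) * (8 / 3 * m)"
    using area_moment_iterate[OF assms(1) g_def, folded m_def]
    unfolding area_moment_translate A_def by (simp only: diff_eq_eq add.commute)
  then have "area_centroid ((midpoint_map ^^ n) v) = g + of_real ((3 / 8) ^ n / A) * (4 / 9 * m)"
    using A by (simp add: area_centroid_def add_divide_distrib mult_ac flip: A_def)
  then show ?thesis
    by (simp only: r m_def g_def)
qed

section \<open>Asymptotics of the position\<close>

text \<open>
  The first form, with bounded denominator, shows the limit; the second, with constant numerator, reduces
  monotonicity to that of the denominator.
\<close>

lemma mode_ratio_rescale:
  "mode_ratio a b n = (1 / 2) ^ n / (a + b * (1 / 3) ^ n)"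
  "mode_ratio a b n = 1 / (a * 2 ^ n + b * (2 / 3) ^ n)"
proof -
  have "mode_ratio a b n = ((1 / 2) ^ n * (3 / 4) ^ n) / ((a + b * (1 / 3) ^ n) * (3 / 4) ^ n)"
    by (simp add: mode_ratio_def ring_distribs mult.assoc flip: power_mult_distrib)
  then show 1: "mode_ratio a b n = (1 / 2) ^ n / (a + b * (1 / 3) ^ n)"
    by simp
  have "mode_ratio a b n = (1 * (3 / 8) ^ n) / ((a * 2 ^ n + b * (2 / 3) ^ n) * (3 / 8) ^ n)"
    by (simp add: mode_ratio_def ring_distribs mult.assoc flip: power_mult_distrib)
  then show "mode_ratio a b n = 1 / (a * 2 ^ n + b * (2 / 3) ^ n)"
    by (simp only: mult_divide_mult_cancel_right) simp
qed

lemma mode_ratio_tendsto_0: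
  assumes "a \<noteq> 0"
  shows "mode_ratio a b \<longlonglongrightarrow> 0"
proof -
  have "(\<lambda>n. (1 / 2) ^ n / (a + b * (1 / 3) ^ n)) \<longlonglongrightarrow> 0 / (a + b * 0)"
    using assms by (intro tendsto_intros LIMSEQ_power_zero) auto
  then show ?thesis
    by (simp add: mode_ratio_rescale(1)[abs_def])
qed

lemma mode_ratio_uminus: "mode_ratio (- a) (- b) n = - mode_ratio a b n"
proof -
  have "- a * (3 / 4) ^ n + - b * (1 / 4) ^ n = - (a * (3 / 4) ^ n + b * (1 / 4) ^ n)"
    by simp
  then show ?thesis
    by (simp only: mode_ratio_def divide_minus_right)
qed

text \<open>
  The denominator \<open>a * 2 ^ n + b * (2 / 3) ^ n\<close> is positive and increasing as soon as \<open>a * 2 ^ n\<close> exceeds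
  \<open>\<bar>b\<bar>\<close>, because the second summand and its increments never exceed \<open>\<bar>b\<bar>\<close> in absolute value.
\<close>

lemma mode_ratio_eventually_antimono:
  assumes "a > 0"
  obtains N where "antimono_on {N..} (mode_ratio a b)"
proof -
  define h where "h n = a * 2 ^ n + b * (2 / 3) ^ n" for n
  obtain N where N: "\<bar>b\<bar> / a < 2 ^ N"
    using real_arch_pow[of 2 "\<bar>b\<bar> / a"] by auto
  have large: "\<bar>b\<bar> < a * 2 ^ n" if "n \<ge> N" for n
  proof -
    have "(2::real) ^ N \<le> 2 ^ n" using that by simp
    with N have "\<bar>b\<bar> / a < 2 ^ n" by linarith
    then show ?thesis using assms by (simp add: field_simps)
  qed
  have small: "\<bar>b * (2 / 3) ^ n\<bar> \<le> \<bar>b\<bar>" for n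
    by (simp add: abs_mult power_le_one mult_left_le)
  have pos: "0 < h n" if "n \<ge> N" for n
    using large[OF that] small[of n] unfolding h_def by linarith
  have step: "h n \<le> h (Suc n)" if "n \<ge> N" for n
  proof -
    have "h (Suc n) - h n = a * 2 ^ n - b * (2 / 3) ^ n / 3"
      by (simp add: h_def)
    then show ?thesis
      using large[OF that] small[of n] by linarith
  qed
  have "h m \<le> h n" if "m \<ge> N" "m \<le> n" for m n
    using that(2,1) by (induction rule: dec_induct) (auto intro: order_trans step)
  then have "antimono_on {N..} (mode_ratio a b)"
    using pos by (intro monotone_onI) (auto simp: mode_ratio_rescale(2) intro!: divide_left_mono simp flip: h_def)
  then show thesis ..
qed

text \<open>
  If \<open>a = 0\<close>, the ratio is the geometric sequence \<open>(3 / 2) ^ n / b\<close>, which is monotone.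
  This includes \<open>b = 0\<close>, where division by zero makes the ratio constantly \<open>0\<close>.
\<close>

lemma mode_ratio_eventually_monotone:
  "\<exists>N. mono_on {N..} (mode_ratio a b) \<or> antimono_on {N..} (mode_ratio a b)"
proof -
  have flip: "mono_on S (mode_ratio a b)" if "antimono_on S (mode_ratio (- a) (- b))" for a b S
    using that by (auto simp: monotone_on_def mode_ratio_uminus)
  consider "a > 0" | "- a > 0" | "a = 0" "b \<ge> 0" | "a = 0" "b \<le> 0"
    by linarith
  then show ?thesis
  proof cases
    case 1
    then show ?thesis using mode_ratio_eventually_antimono by metis
  next
    case 2
    then show ?thesis using mode_ratio_eventually_antimono flip by metis
  next
    case 3
    have "mode_ratio a b n = (3 / 2) ^ n / b" for n
      using 3 by (simp add: mode_ratio_rescale(2) power_divide)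
    then have "mono_on {0..} (mode_ratio a b)"
      using 3 by (intro monotone_onI) (auto intro!: divide_right_mono power_increasing)
    then show ?thesis by blast
  next
    case 4
    have "mode_ratio a b n = (3 / 2) ^ n / b" for n
      using 4 by (simp add: mode_ratio_rescale(2) power_divide)
    then have "antimono_on {0..} (mode_ratio a b)"
      using 4 by (intro monotone_onI) (auto intro!: divide_right_mono_neg power_increasing)
    then show ?thesis by blast
  qed
qed

section \<open>Collinearity, monotonicity and convergence\<close>

theorem theorem1:
  fixes v :: "complex ^ 6"
  shows "\<exists>(p::complex) (d::complex) (t :: nat \<Rightarrow> real).
    d \<noteq> 0 \<and>
    (\<forall>n\<ge>1. signed_area ((midpoint_map ^^ n) v) \<noteq> 0 \<longrightarrow>
       area_centroid ((midpoint_map ^^ n) v) = p + of_real (t n) * d) \<and>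
    (\<exists>N. mono_on {n. n \<ge> N \<and> signed_area ((midpoint_map ^^ n) v) \<noteq> 0} t \<or>
         antimono_on {n. n \<ge> N \<and> signed_area ((midpoint_map ^^ n) v) \<noteq> 0} t) \<and>
    (\<not> escaping v \<longrightarrow>
       ((\<lambda>n. area_centroid ((midpoint_map ^^ n) v)) \<longlongrightarrow> vertex_centroid v)
         (inf sequentially (principal {n. signed_area ((midpoint_map ^^ n) v) \<noteq> 0})))"
proof -
  define area where "area n = signed_area ((midpoint_map ^^ n) v)" for n
  define G where "G n = area_centroid ((midpoint_map ^^ n) v)" for n
  define g where "g = vertex_centroid v"
  define a where "a = (signed_area v + triangles_area v) / 2"
  define b where "b = (signed_area v - triangles_area v) / 2"
  define w where "w = 4 / 9 * area_moment (\<chi> k. midpoint_map v $ k - g)"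
  have area: "area n = a * (3 / 4) ^ n + b * (1 / 4) ^ n" for n
    unfolding area_def a_def b_def by (rule signed_area_iterate)
  have G: "G n = g + of_real (mode_ratio a b n) * w" if "n \<ge> 1" "area n \<noteq> 0" for n
    using area_centroid_iterate[of n v] that by (simp add: G_def area_def a_def b_def g_def w_def)

  \<comment> \<open>If \<open>w = 0\<close>, the centroids do not move; any direction is then a direction of the line.\<close>
  define d where "d = (if w = 0 then 1 else w)"
  define t where "t n = (if w = 0 then 0 else mode_ratio a b n)" for n
  have "d \<noteq> 0"
    by (simp add: d_def)
  have line: "\<forall>n\<ge>1. area n \<noteq> 0 \<longrightarrow> G n = g + of_real (t n) * d"
    using G by (simp add: d_def t_def)
  have monotone: "\<exists>N. mono_on {n. n \<ge> N \<and> area n \<noteq> 0} t \<or> antimono_on {n. n \<ge> N \<and> area n \<noteq> 0} t"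
  proof (cases "w = 0")
    case True
    then show ?thesis by (simp add: t_def monotone_on_def)
  next
    case False
    then have "t = mode_ratio a b"
      by (simp add: t_def fun_eq_iff)
    then show ?thesis
      using mode_ratio_eventually_monotone[of a b]
      by (auto simp: monotone_on_def)
  qed
  have limit: "(G \<longlongrightarrow> g) (inf sequentially (principal {n. area n \<noteq> 0}))" if "\<not> escaping v"
  proof -
    have "(\<lambda>n. g + of_real (mode_ratio a b n) * w) \<longlonglongrightarrow> g" if "a \<noteq> 0 \<or> w = 0"
    proof (cases "w = 0")
      case False
      with that have "(\<lambda>n. g + of_real (mode_ratio a b n) * w) \<longlonglongrightarrow> g + of_real 0 * w"
        by (intro tendsto_intros mode_ratio_tendsto_0) auto
      then show ?thesis by simp
    qed simp
    \<comment> \<open>If \<open>a = 0\<close> while \<open>b\<close> and \<open>w\<close> are nonzero, the hexagon is escaping, as \<open>n = 1\<close> shows.\<close>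
    moreover have "a \<noteq> 0 \<or> w = 0 \<or> b = 0"
    proof (rule ccontr)
      assume *: "\<not> (a \<noteq> 0 \<or> w = 0 \<or> b = 0)"
      then have "area 1 \<noteq> 0"
        by (simp add: area)
      moreover have "G 1 \<noteq> g"
        using * G[of 1] \<open>area 1 \<noteq> 0\<close> by (simp add: mode_ratio_def)
      moreover have "cmod (fourier_coeff v 1) = cmod (fourier_coeff v 5)"
        using * signed_area_add_triangles_area_fourier[of v]
        by (simp add: a_def)
      ultimately show False
        using \<open>\<not> escaping v\<close> by (simp add: escaping_def area_def G_def g_def)
    qed
    moreover have "\<forall>\<^sub>F n in inf sequentially (principal {n. area n \<noteq> 0}).
        g + of_real (mode_ratio a b n) * w = G n"
      unfolding eventually_inf_principal using G by (auto intro: eventually_sequentiallyI[of 1])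
    \<comment> \<open>In the remaining case every area vanishes and the limit is vacuous.\<close>
    moreover have "inf sequentially (principal {n. area n \<noteq> 0}) = bot" if "a = 0" "b = 0"
      using that by (simp add: area)
    ultimately show ?thesis
      by (cases "a \<noteq> 0 \<or> w = 0") (auto intro: Lim_transform_eventually tendsto_mono[OF inf_le1])
  qed
  show ?thesis
    using \<open>d \<noteq> 0\<close> line monotone limit unfolding area_def G_def g_def
    by (intro exI[of _ "vertex_centroid v"] exI[of _ d] exI[of _ t] conjI impI)
qed

end
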